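(* Let $E \subseteq [3]\times[3]$. Then every partial nonnegative matrix with observed entries in $E$ can be completed to a nonnegative rank at most two matrix in $\mathbb{R}^{3\times 3}$ if and only if it can be completed to a rank at most two matrix in $\mathbb{R}^{3\times 3}$, unless all missing entries are in different rows and columns.
   Context: $[n]=\{1,\dots,n\}$. For $E\subseteq[3]\times[3]$, a partial matrix $M_E \in \mathbb{R}^E$ specifies the entries in the positions in $E$ (the observed entries); the positions in $([3]\times[3])\setminus E$ are the missing entries. A partial nonnegative matrix is a partial matrix whose observed entries are nonnegative. A completion of $M_E$ is a matrix in $\mathbb{R}^{3\times 3}$ that agrees with $M_E$ on $E$. The nonnegative rank of a matrix $M\in\mathbb{R}_{\ge 0}^{p\times q}$ with nonnegative entries is the smallest $r$ such that $M=AB$ with $A\in\mathbb{R}_{\ge 0}^{p\times r}$ and $B\in\mathbb{R}_{\ge 0}^{r\times q}$; a nonnegative rank at most two matrix is a matrix with nonnegative entries whose nonnegative rank is at most two. *)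

theory Defs
  imports "HOL-Analysis.Analysis" "HOL-Library.FuncSet"
begin

definition nonneg_mat :: "real ^ 'q ^ 'p \<Rightarrow> bool" where
  "nonneg_mat M \<longleftrightarrow> (\<forall>i j. 0 \<le> M $ i $ j)"

(* The inner dimension r varies, so the factors A (of size p x r) and B (of size r x q)
   are functions with the inner index ranging over k < r. *)
definition nonneg_factorization ::
    "real ^ 'q ^ 'p \<Rightarrow> nat \<Rightarrow> ('p \<Rightarrow> nat \<Rightarrow> real) \<Rightarrow> (nat \<Rightarrow> 'q \<Rightarrow> real) \<Rightarrow> bool" where
  "nonneg_factorization M r A B \<longleftrightarrow>
     (\<forall>i. \<forall>k<r. 0 \<le> A i k) \<and> (\<forall>k<r. \<forall>j. 0 \<le> B k j) \<and>
     (\<forall>i j. M $ i $ j = (\<Sum>k<r. A i k * B k j))"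

(* Meaningful only for entrywise nonnegative M; otherwise no factorization exists and
   the value is unspecified. *)
definition nonneg_rank :: "real ^ 'q ^ 'p \<Rightarrow> nat" where
  "nonneg_rank M = (LEAST r. \<exists>A B. nonneg_factorization M r A B)"

(* The space of functions on E: values outside E are fixed to undefined. *)
definition partial_matrices :: "('p \<times> 'q) set \<Rightarrow> ('p \<times> 'q \<Rightarrow> real) set" where
  "partial_matrices E = E \<rightarrow>\<^sub>E UNIV"

definition nonneg_partial_matrices :: "('p \<times> 'q) set \<Rightarrow> ('p \<times> 'q \<Rightarrow> real) set" where
  "nonneg_partial_matrices E = {m \<in> partial_matrices E. \<forall>e\<in>E. 0 \<le> m e}"

definition is_completion ::
    "('p \<times> 'q) set \<Rightarrow> ('p \<times> 'q \<Rightarrow> real) \<Rightarrow> real ^ 'q ^ 'p \<Rightarrow> bool" where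
  "is_completion E m M \<longleftrightarrow> (\<forall>(i, j)\<in>E. M $ i $ j = m (i, j))"

definition in_different_rows_and_columns :: "('p \<times> 'q) set \<Rightarrow> bool" where
  "in_different_rows_and_columns S \<longleftrightarrow>
     (\<forall>e\<in>S. \<forall>f\<in>S. e \<noteq> f \<longrightarrow> fst e \<noteq> fst f \<and> snd e \<noteq> snd f)"

end

theory Submission
  imports Defs
begin

text \<open>Up to transposition, two entries of some row r are missing; let e be the remaining column.
  Fill all other missing entries outside row r with 1. Row r can then be taken to be a nonnegative
  multiple of another row, unless column e is fully observed with its only nonzero entry in row r.
  In that case the complementary 2 x 2 minor of any rank two completion vanishes, and it still does
  after taking absolute values; adding the entry at (r, e) and zeros elsewhere gives nonnegative
  rank at most two.\<close>

lemma third_index: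
  fixes a b :: 3
  assumes "a \<noteq> b"
  obtains c where "c \<noteq> a" "c \<noteq> b" "\<And>x. x = a \<or> x = b \<or> x = c"
proof -
  have "card (- {a, b}) = 1"
    using assms by (simp add: Compl_eq_Diff_UNIV card_Diff_subset)
  then obtain c where "- {a, b} = {c}"
    by (rule card_1_singletonE)
  then show ?thesis
    by (intro that[of c]) auto
qed

lemma rank_le_2_iff_det_eq_0:
  fixes M :: "real ^ 3 ^ 3"
  shows "rank M \<le> 2 \<longleftrightarrow> det M = 0"
  using det_eq_0_rank[of M] by auto

text \<open>Take a nonzero kernel vector \<open>x\<close>. If its coordinates at \<open>c\<close>
  and \<open>d\<close> both vanished, row \<open>r\<close> would force the one at \<open>e\<close>
  to vanish too. Rows \<open>s\<close> and \<open>t\<close> do not see column \<open>e\<close>, so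
  the pair of coordinates at \<open>c\<close> and \<open>d\<close> is a nonzero kernel vector of the
  2 x 2 submatrix.\<close>

lemma minor_eq_0_if_det_eq_0:
  fixes M :: "real ^ 3 ^ 3"
  assumes det: "det M = 0"
    and cols: "c \<noteq> d" "c \<noteq> e" "d \<noteq> e"
    and entries: "M $ r $ e \<noteq> 0" "M $ s $ e = 0" "M $ t $ e = 0"
  shows "M $ s $ c * M $ t $ d = M $ s $ d * M $ t $ c"
proof -
  obtain x where x: "x \<noteq> 0" "M *v x = 0"
    using det invertible_det_nz[of M] matrix_left_invertible_ker[of M] invertible_left_inverse[of M]
    by blast
  have univ: "(UNIV :: 3 set) = {c, d, e}"
  proof -
    obtain e' where e': "e' \<noteq> c" "e' \<noteq> d" "\<And>x. x = c \<or> x = d \<or> x = e'"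
      using third_index[OF cols(1)] by blast
    with cols have "e = e'" by metis
    with e' show ?thesis by auto
  qed
  have row: "M $ i $ c * x $ c + M $ i $ d * x $ d + M $ i $ e * x $ e = 0" for i
    using arg_cong[OF x(2), of "\<lambda>v. v $ i"] cols
    by (simp add: matrix_vector_mult_def univ algebra_simps)
  have "x $ c \<noteq> 0 \<or> x $ d \<noteq> 0"
  proof (rule ccontr)
    assume "\<not> ?thesis"
    then have zero: "x $ c = 0" "x $ d = 0" by auto
    with row[of r] entries have "x $ e = 0" by simp
    have "x $ i = 0" for i
      using zero \<open>x $ e = 0\<close> univ UNIV_I[of i] by auto
    then have "x = 0" by (simp add: vec_eq_iff)
    with x show False by simp
  qed
  moreover have s: "M $ s $ c * x $ c + M $ s $ d * x $ d = 0"
    and t: "M $ t $ c * x $ c + M $ t $ d * x $ d = 0"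
    using row[of s] row[of t] entries by simp_all
  \<comment> \<open>Cramer's rule: eliminating one coordinate between \<open>s\<close> and
    \<open>t\<close> leaves the minor times the other.\<close>
  have "(M $ s $ c * M $ t $ d - M $ s $ d * M $ t $ c) * x $ c = 0"
    "(M $ s $ c * M $ t $ d - M $ s $ d * M $ t $ c) * x $ d = 0"
    using s t by algebra+
  ultimately show ?thesis by auto
qed

text \<open>A nonzero first row serves as \<open>(v, w)\<close> with \<open>a = 1\<close>, and
  \<open>b\<close> is the ratio of the rows, read off at a positive entry. If the first row is zero,
  the second serves with \<open>a = 0\<close>.\<close>

lemma nonneg_rank_one_2x2:
  fixes p q p' q' :: real
  assumes "p * q' = q * p'" "0 \<le> p" "0 \<le> q" "0 \<le> p'" "0 \<le> q'"
  obtains a b v w where "0 \<le> a" "0 \<le> b" "0 \<le> v" "0 \<le> w"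
    "p = a * v" "q = a * w" "p' = b * v" "q' = b * w"
proof -
  consider "p = 0" "q = 0" | "p > 0" | "q > 0"
    using assms by linarith
  then show ?thesis
  proof cases
    case 1
    then show ?thesis using that[of 0 1 p' q'] assms by simp
  next
    case 2
    then show ?thesis using that[of 1 "p' / p" p q] assms by (simp add: field_simps)
  next
    case 3
    then show ?thesis using that[of 1 "q' / q" p q] assms by (simp add: field_simps)
  qed
qed

text \<open>Restates completability to nonnegative rank at most two without the completion and
  without \<open>LEAST\<close>. Two terms cover the smaller ranks as well, since a dyad may be
  zero.\<close>

definition nonneg_dyads :: "('p \<times> 'q) set \<Rightarrow> ('p \<times> 'q \<Rightarrow> real) \<Rightarrow> bool" where
  "nonneg_dyads E m \<longleftrightarrow> (\<exists>u v u' v'.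
     (\<forall>i. 0 \<le> u i) \<and> (\<forall>j. 0 \<le> v j) \<and> (\<forall>i. 0 \<le> u' i) \<and> (\<forall>j. 0 \<le> v' j) \<and>
     (\<forall>(i, j)\<in>E. m (i, j) = u i * v j + u' i * v' j))"

lemma nonneg_dyadsI:
  assumes "\<And>i. 0 \<le> u i" "\<And>j. 0 \<le> v j" "\<And>i. 0 \<le> u' i" "\<And>j. 0 \<le> v' j"
    and "\<And>i j. (i, j) \<in> E \<Longrightarrow> m (i, j) = u i * v j + u' i * v' j"
  shows "nonneg_dyads E m"
  unfolding nonneg_dyads_def using assms
  by (intro exI[of _ u] exI[of _ v] exI[of _ u'] exI[of _ v']) auto

lemma nonneg_dyadsE:
  assumes "nonneg_dyads E m"
  obtains u v u' v' where "\<And>i. 0 \<le> u i" "\<And>j. 0 \<le> v j" "\<And>i. 0 \<le> u' i" "\<And>j. 0 \<le> v' j"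
    and "\<And>i j. (i, j) \<in> E \<Longrightarrow> m (i, j) = u i * v j + u' i * v' j"
  using assms unfolding nonneg_dyads_def by (elim exE conjE) (rule that; auto)

text \<open>Reduces two missing entries in a column to two missing entries in a row.\<close>

lemma nonneg_dyads_transpose:
  assumes "nonneg_dyads (prod.swap ` E) (m \<circ> prod.swap)"
  shows "nonneg_dyads E m"
proof -
  obtain u v u' v' where nn: "\<And>i. 0 \<le> u i" "\<And>j. 0 \<le> v j" "\<And>i. 0 \<le> u' i" "\<And>j. 0 \<le> v' j"
    and eq: "\<And>j i. (j, i) \<in> prod.swap ` E \<Longrightarrow> (m \<circ> prod.swap) (j, i) = u j * v i + u' j * v' i"
    using nonneg_dyadsE[OF assms] by blast
  show ?thesis
  proof (rule nonneg_dyadsI[of v u v' u'])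
    fix i j assume "(i, j) \<in> E"
    then show "m (i, j) = v i * u j + v' i * u' j"
      using eq[of j i] by (simp add: mult.commute)
  qed (fact nn)+
qed

lemma nonneg_completion_iff_dyads:
  fixes m :: "'p::finite \<times> 'q::finite \<Rightarrow> real"
  shows "(\<exists>M :: real ^ 'q ^ 'p. is_completion E m M \<and> nonneg_mat M \<and> nonneg_rank M \<le> 2)
    \<longleftrightarrow> nonneg_dyads E m"
proof
  assume "\<exists>M :: real ^ 'q ^ 'p. is_completion E m M \<and> nonneg_mat M \<and> nonneg_rank M \<le> 2"
  then obtain M :: "real ^ 'q ^ 'p"
    where M: "is_completion E m M" "nonneg_mat M" "nonneg_rank M \<le> 2"
    by blast
  obtain f where f: "bij_betw f {..<CARD('p)} (UNIV :: 'p set)"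
    using ex_bij_betw_nat_finite[of "UNIV :: 'p set"] by (auto simp: atLeast0LessThan)
  \<comment> \<open>The factorization of \<open>M\<close> as identity times \<open>M\<close>, with
    rows enumerated by \<open>f\<close>. It shows that the \<open>LEAST\<close> in
    \<open>nonneg_rank\<close> is attained.\<close>
  have "nonneg_factorization M CARD('p) (\<lambda>i k. of_bool (i = f k)) (\<lambda>k j. M $ f k $ j)"
    unfolding nonneg_factorization_def
  proof (intro conjI allI impI)
    fix i j
    have "(\<Sum>k<CARD('p). of_bool (i = f k) * M $ f k $ j) = (\<Sum>l\<in>UNIV. of_bool (i = l) * M $ l $ j)"
      using sum.reindex_bij_betw[OF f, of "\<lambda>l. of_bool (i = l) * M $ l $ j"] by simp
    also have "\<dots> = M $ i $ j" by simp
    finally show "M $ i $ j = (\<Sum>k<CARD('p). of_bool (i = f k) * M $ f k $ j)" by simp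
  qed (use M(2) in \<open>auto simp: nonneg_mat_def\<close>)
  then have "\<exists>r A B. nonneg_factorization M r A B" by blast
  then have "\<exists>A B. nonneg_factorization M (nonneg_rank M) A B"
    unfolding nonneg_rank_def by (rule LeastI_ex)
  then obtain A B where AB: "nonneg_factorization M (nonneg_rank M) A B" by blast
  define r where "r = nonneg_rank M"
  have r: "r = 0 \<or> r = 1 \<or> r = 2" using M(3) r_def by linarith
  \<comment> \<open>A factorization with fewer than two terms is padded with zero dyads.\<close>
  show "nonneg_dyads E m"
    by (rule nonneg_dyadsI[of "\<lambda>i. if 0 < r then A i 0 else 0" "\<lambda>j. if 0 < r then B 0 j else 0"
          "\<lambda>i. if 1 < r then A i 1 else 0" "\<lambda>j. if 1 < r then B 1 j else 0"])
      (use AB M(1) r in \<open>auto simp: nonneg_factorization_def is_completion_def r_def[symmetric]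
          numeral_2_eq_2\<close>)
next
  assume "nonneg_dyads E m"
  then obtain u v u' v'
    where nn: "\<And>i. 0 \<le> u i" "\<And>j. 0 \<le> v j" "\<And>i. 0 \<le> u' i" "\<And>j. 0 \<le> v' j"
      and eq: "\<And>i j. (i, j) \<in> E \<Longrightarrow> m (i, j) = u i * v j + u' i * v' j"
    by (rule nonneg_dyadsE) blast
  define M :: "real ^ 'q ^ 'p" where "M = (\<chi> i j. u i * v j + u' i * v' j)"
  have "nonneg_factorization M 2 (\<lambda>i k. if k = 0 then u i else u' i)
      (\<lambda>k j. if k = 0 then v j else v' j)"
    using nn by (auto simp: nonneg_factorization_def M_def numeral_2_eq_2)
  then have "nonneg_rank M \<le> 2"
    unfolding nonneg_rank_def by (intro Least_le) blast
  moreover have "is_completion E m M" "nonneg_mat M"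
    using nn eq by (auto simp: is_completion_def nonneg_mat_def M_def)
  ultimately show "\<exists>M :: real ^ 'q ^ 'p. is_completion E m M \<and> nonneg_mat M \<and> nonneg_rank M \<le> 2"
    by blast
qed

lemma det_eq_0_completion_if_dyads:
  fixes m :: "3 \<times> 3 \<Rightarrow> real"
  assumes "nonneg_dyads E m"
  shows "\<exists>M :: real ^ 3 ^ 3. is_completion E m M \<and> det M = 0"
proof -
  obtain u v u' v'
    where "\<And>i. 0 \<le> u i" "\<And>j. 0 \<le> v j" "\<And>i. 0 \<le> u' i" "\<And>j. 0 \<le> v' j"
      and eq: "\<And>i j. (i, j) \<in> E \<Longrightarrow> m (i, j) = u i * v j + u' i * v' j"
    using nonneg_dyadsE[OF assms] by blast
  define M :: "real ^ 3 ^ 3" where "M = (\<chi> i j. u i * v j + u' i * v' j)"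
  have "det M = 0"
    \<comment> \<open>The determinant of a sum of two dyads is the zero polynomial in their
      entries.\<close>
    unfolding det_3 M_def vec_lambda_beta by algebra
  moreover have "is_completion E m M"
    using eq by (auto simp: is_completion_def M_def)
  ultimately show ?thesis by blast
qed

text \<open>With gaps filled by 1, rows \<open>s\<close> and \<open>t\<close> span the completion
  and row \<open>r\<close> becomes \<open>l\<close> times row \<open>s\<close>. Only the entry at
  \<open>(r, e)\<close> has to be matched, and \<open>pivot\<close> makes the required division
  possible.\<close>

lemma nonneg_dyads_if_multiple_row:
  fixes m :: "3 \<times> 'q \<Rightarrow> real"
  assumes rows: "r \<noteq> s" "r \<noteq> t" "s \<noteq> t"
    and nonneg: "\<forall>x\<in>E. 0 \<le> m x" and only: "\<And>j. (r, j) \<in> E \<Longrightarrow> j = e"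
    and pivot: "(r, e) \<in> E \<Longrightarrow> m (r, e) \<noteq> 0 \<Longrightarrow> (s, e) \<in> E \<Longrightarrow> m (s, e) \<noteq> 0"
  shows "nonneg_dyads E m"
proof -
  define P where "P i j = (if (i, j) \<in> E then m (i, j) else 1)" for i j
  \<comment> \<open>If \<open>P s e = 0\<close>, then \<open>pivot\<close> forces an observed
    \<open>m (r, e)\<close> to be 0, so \<open>l * P s e = m (r, e)\<close> holds even though the
    division is by zero.\<close>
  define l where "l = (if (r, e) \<in> E then m (r, e) / P s e else 0)"
  have P: "0 \<le> P i j" for i j
    using nonneg by (auto simp: P_def)
  have l: "0 \<le> l"
    using nonneg P by (auto simp: l_def)
  have univ: "i = r \<or> i = s \<or> i = t" for i
    using third_index[OF rows(1)] rows by metis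
  show ?thesis
  proof (rule nonneg_dyadsI[of "\<lambda>i. if i = r then l else of_bool (i = s)" "P s"
        "\<lambda>i. of_bool (i = t)" "P t"])
    fix i j assume ij: "(i, j) \<in> E"
    show "m (i, j) = (if i = r then l else of_bool (i = s)) * P s j + of_bool (i = t) * P t j"
      using univ[of i]
    proof (elim disjE)
      assume i: "i = r"
      with ij only have "j = e" by blast
      then show ?thesis
        using i ij rows pivot by (auto simp: l_def P_def)
    qed (use ij rows in \<open>auto simp: P_def\<close>)
  qed (use P l in auto)
qed

lemma nonneg_dyads_if_missing_in_row:
  fixes M :: "real ^ 3 ^ 3"
  assumes det: "det M = 0" and M: "is_completion E m M" and nonneg: "\<forall>x\<in>E. 0 \<le> m x"
    and missing: "(r, c) \<notin> E" "(r, d) \<notin> E" "c \<noteq> d"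
  shows "nonneg_dyads E m"
proof -
  obtain e where e: "e \<noteq> c" "e \<noteq> d" "\<And>x. x = c \<or> x = d \<or> x = e"
    using third_index[OF \<open>c \<noteq> d\<close>] by blast
  \<comment> \<open>Rows and columns share the index type, so one of \<open>c\<close> and
    \<open>d\<close> differs from \<open>r\<close>.\<close>
  obtain s where "s \<noteq> r"
    using missing(3) by metis
  then obtain t where t: "t \<noteq> r" "t \<noteq> s" "\<And>x. x = r \<or> x = s \<or> x = t"
    using third_index[of r s] by metis
  have only: "(r, j) \<in> E \<Longrightarrow> j = e" for j
    using e(3)[of j] missing by auto
  have m: "(i, j) \<in> E \<Longrightarrow> m (i, j) = M $ i $ j" for i j
    using M by (auto simp: is_completion_def)
  \<comment> \<open>Outside the exceptional case, \<open>s\<close> or \<open>t\<close> can serve as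
    the row that \<open>r\<close> is a multiple of.\<close>
  show ?thesis
  proof (cases "(r, e) \<in> E \<and> m (r, e) \<noteq> 0 \<and> (s, e) \<in> E \<and> m (s, e) = 0 \<and> (t, e) \<in> E \<and> m (t, e) = 0")
    case False
    then consider "\<not> ((r, e) \<in> E \<and> m (r, e) \<noteq> 0 \<and> (s, e) \<in> E \<and> m (s, e) = 0)"
      | "\<not> ((r, e) \<in> E \<and> m (r, e) \<noteq> 0 \<and> (t, e) \<in> E \<and> m (t, e) = 0)"
      by argo
    then show ?thesis
    proof cases
      case 1
      then show ?thesis
        using \<open>s \<noteq> r\<close> t(1,2)
        by (intro nonneg_dyads_if_multiple_row[of r s t E m e, OF _ _ _ nonneg only]) simp_all
    next
      case 2
      then show ?thesis
        using \<open>s \<noteq> r\<close> t(1,2)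
        by (intro nonneg_dyads_if_multiple_row[of r t s E m e, OF _ _ _ nonneg only]) simp_all
    qed
  next
    case True
    then have "M $ s $ c * M $ t $ d = M $ s $ d * M $ t $ c"
      using m e(1,2) missing(3)
      by (intro minor_eq_0_if_det_eq_0[OF det, of c d e r s t]) auto
    \<comment> \<open>Missing entries of the minor may be negative, but absolute values keep it singular.\<close>
    then have abs_minor: "\<bar>M $ s $ c\<bar> * \<bar>M $ t $ d\<bar> = \<bar>M $ s $ d\<bar> * \<bar>M $ t $ c\<bar>"
      by (metis abs_mult)
    obtain a b v w where nn: "0 \<le> a" "0 \<le> b" "0 \<le> v" "0 \<le> w"
      and eq: "\<bar>M $ s $ c\<bar> = a * v" "\<bar>M $ s $ d\<bar> = a * w" "\<bar>M $ t $ c\<bar> = b * v" "\<bar>M $ t $ d\<bar> = b * w"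
      using nonneg_rank_one_2x2[OF abs_minor abs_ge_zero abs_ge_zero abs_ge_zero abs_ge_zero] by blast
    \<comment> \<open>The first dyad carries the absolute values of the minor on rows
      \<open>s\<close>, \<open>t\<close> and columns \<open>c\<close>, \<open>d\<close>; the second
      carries the single entry at \<open>(r, e)\<close>.\<close>
    show ?thesis
    proof (rule nonneg_dyadsI[of "\<lambda>i. if i = r then 0 else if i = s then a else b"
          "\<lambda>j. if j = e then 0 else if j = c then v else w"
          "\<lambda>i. of_bool (i = r)" "\<lambda>j. if j = e then m (r, e) else 0"])
      fix i j assume ij: "(i, j) \<in> E"
      \<comment> \<open>Observed entries are nonnegative, so taking absolute values leaves them
        unchanged.\<close>
      then have abs: "m (i, j) = \<bar>M $ i $ j\<bar>"
        using m[of i j] bspec[OF nonneg, of "(i, j)"] by simp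
      consider "i = r" | "i = s" "j = c" | "i = s" "j = d" | "i = t" "j = c" | "i = t" "j = d"
        | "i = s" "j = e" | "i = t" "j = e"
        using t(3)[of i] e(3)[of j] by blast
      then show "m (i, j) = (if i = r then 0 else if i = s then a else b) *
          (if j = e then 0 else if j = c then v else w) +
          of_bool (i = r) * (if j = e then m (r, e) else 0)"
      proof cases
        case 1
        then show ?thesis using only[of j] ij by simp
      qed (use \<open>s \<noteq> r\<close> t(1,2) e(1,2) missing(3) abs eq True in simp_all)
    qed (use nn bspec[OF nonneg, of "(r, e)"] True in simp_all)
  qed
qed

theorem theorem3p6:
  fixes E :: "(3 \<times> 3) set"
  assumes "\<not> in_different_rows_and_columns (- E)"
  shows "\<forall>m \<in> nonneg_partial_matrices E.
           (\<exists>M :: real ^ 3 ^ 3. is_completion E m M \<and> nonneg_mat M \<and> nonneg_rank M \<le> 2) \<longleftrightarrow>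
           (\<exists>M :: real ^ 3 ^ 3. is_completion E m M \<and> rank M \<le> 2)"
proof
  fix m assume "m \<in> nonneg_partial_matrices E"
  then have nonneg: "\<forall>x\<in>E. 0 \<le> m x"
    by (simp add: nonneg_partial_matrices_def)
  have "nonneg_dyads E m" if M: "is_completion E m M" "det M = 0" for M :: "real ^ 3 ^ 3"
  proof -
    obtain x y where "x \<notin> E" "y \<notin> E" "x \<noteq> y" "fst x = fst y \<or> snd x = snd y"
      using assms unfolding in_different_rows_and_columns_def by blast
    then obtain i j i' j' where miss: "(i, j) \<notin> E" "(i', j') \<notin> E" "(i, j) \<noteq> (i', j')" "i = i' \<or> j = j'"
      by (cases x, cases y) simp
    show ?thesis
    proof (cases "i = i'")
      case True
      then show ?thesis
        using nonneg_dyads_if_missing_in_row[OF M(2,1) nonneg, of i j j'] miss by auto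
    next
      case False
      \<comment> \<open>The two missing entries now share column \<open>j\<close>, which is a row of
        the transpose.\<close>
      have "is_completion (prod.swap ` E) (m \<circ> prod.swap) (transpose M)"
        using M(1) by (auto simp: is_completion_def transpose_def)
      moreover have "det (transpose M) = 0"
        using M(2) by simp
      moreover have "\<forall>x\<in>prod.swap ` E. 0 \<le> (m \<circ> prod.swap) x"
        using nonneg by auto
      ultimately have "nonneg_dyads (prod.swap ` E) (m \<circ> prod.swap)"
        using nonneg_dyads_if_missing_in_row[of "transpose M" _ _ j i i'] miss False by auto
      then show ?thesis by (rule nonneg_dyads_transpose)
    qed
  qed
  then show "(\<exists>M :: real ^ 3 ^ 3. is_completion E m M \<and> nonneg_mat M \<and> nonneg_rank M \<le> 2) \<longleftrightarrow>
           (\<exists>M :: real ^ 3 ^ 3. is_completion E m M \<and> rank M \<le> 2)"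
    unfolding nonneg_completion_iff_dyads rank_le_2_iff_det_eq_0
    using det_eq_0_completion_if_dyads by blast
qed

end
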